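(* Let $H$ be an atomic monoid whose set of distances $\Delta(H)$ is finite and nonempty, and let $d=\min\Delta(H)$. Suppose that either $\rho_k(H)=\infty$ for some $k\in\mathbb N$, or that there is an $M\in\mathbb N$ such that $\rho_k(H)-\rho_{k-1}(H)\le M$ for all $k\ge 2$. Then: 1. There exist constants $k^*, M^*\in\mathbb N$ such that for all $k\ge k^*$, $\mathcal U_k(H)$ is an almost arithmetical progression (AAP) with difference $d$ and bound $M^*$. Moreover, if $\rho_k(H)<\infty$ for all $k\in\mathbb N$, then the assertion holds for $k^*=1$. 2. We have $$\lim_{k\to\infty}\frac{|\mathcal U_k(H)|}{k}=\frac1d\Bigl(\rho(H)-\frac1{\rho(H)}\Bigr).$$
   Context: $\mathbb N$ is the set of positive integers, $\mathbb N_0=\mathbb N\cup\{0\}$, and $[a,b]=\{x\in\mathbb Z\mid a\le x\le b\}$. A monoid is a cancelative (not necessarily commutative) semigroup with identity, and $H^\times$ is its group of invertible elements. An atom is an element $a\in H\setminus H^\times$ such that $a=uv$ with $u,v\in H$ implies $u\in H^\times$ or $v\in H^\times$; $\mathcal A(H)$ is the set of atoms. $H$ is atomic if every element of $H\setminus H^\times$ is a finite product of atoms. For $a\in H\setminus H^\times$, $\mathsf L(a)=\{k\in\mathbb N\mid a \text{ is a product of } k \text{ atoms}\}$; $\mathsf L(a)=\{0\}$ for $a\in H^\times$. $\mathcal L(H)=\{\mathsf L(a)\mid a\in H\}$. For $L\subset\mathbb Z$, $\Delta(L)$ is the set of all $d\in\mathbb N$ for which there are $k,\ell\in L$ with $\ell-k=d$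 and $[k,\ell]\cap L=\{k,\ell\}$. The set of distances of $H$ is $\Delta(H)=\bigcup_{L\in\mathcal L(H)}\Delta(L)$. For nonempty $L\subset\mathbb N$, $\rho(L)=\sup L/\min L$, and $\rho(\{0\})=1$. The elasticity is $\rho(H)=\sup\{\rho(L)\mid L\in\mathcal L(H)\}\in\mathbb R_{\ge1}\cup\{\infty\}$. If $H\neq H^\times$, then for $k\in\mathbb N$, $\mathcal U_k(H)$ is the set of all $\ell\in\mathbb N$ such that there are atoms $u_1,\dots,u_k,v_1,\dots,v_\ell$ with $u_1\cdots u_k=v_1\cdots v_\ell$ (if $H=H^\times$, $\mathcal U_k(H)=\{k\}$), and $\rho_k(H)=\sup\mathcal U_k(H)$. Convention: $1/\infty=0$; in part 2 both sides are allowed to be $\infty$. AAP: for $d\in\mathbb N$ and $M\in\mathbb N_0$, a set $L\subset\mathbb Z$ is an almost arithmetical progression with difference $d$ and bound $M$ if $L=y+(L'\cup L^*\cup L'')\subset y+d\mathbb Z$, where $y\in\mathbb Z$, $L^*$ is a nonempty (finite or infinite) arithmetical progression with difference $d$ (a singleton is allowed) such that $\min L^*=0$, $L'\subset[-M,-1]$, and $L''\subset\sup L^*+[1,M]$ (with $L''=\emptyset$ if $L^*$ is infinite). *)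

theory Defs
  imports "HOL-Algebra.Divisibility" "HOL-Library.Extended_Real"
begin

text \<open>
  Monoids are cancellative and not necessarily commutative, i.e. instances of the
  locale \<^locale>\<open>monoid_cancel\<close>.  The library predicate \<^const>\<open>irreducible\<close> is phrased through
  (one-sided) proper divisors and does not include membership in the carrier, so atoms are
  defined directly.
\<close>

definition atoms :: "('a, 'b) monoid_scheme \<Rightarrow> 'a set" where
  "atoms G = {a \<in> carrier G - Units G.
     \<forall>u\<in>carrier G. \<forall>v\<in>carrier G. a = u \<otimes>\<^bsub>G\<^esub> v \<longrightarrow> u \<in> Units G \<or> v \<in> Units G}"

definition list_product :: "('a, 'b) monoid_scheme \<Rightarrow> 'a list \<Rightarrow> 'a" where
  "list_product G us = foldr (\<otimes>\<^bsub>G\<^esub>) us \<one>\<^bsub>G\<^esub>"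

definition atomic_monoid :: "('a, 'b) monoid_scheme \<Rightarrow> bool" where
  "atomic_monoid G \<longleftrightarrow> monoid_cancel G \<and>
     (\<forall>a\<in>carrier G - Units G. \<exists>us. set us \<subseteq> atoms G \<and> list_product G us = a)"

definition length_set :: "('a, 'b) monoid_scheme \<Rightarrow> 'a \<Rightarrow> nat set" where
  "length_set G a =
     (if a \<in> Units G then {0}
      else {k. 1 \<le> k \<and> (\<exists>us. length us = k \<and> set us \<subseteq> atoms G \<and> list_product G us = a)})"

definition length_system :: "('a, 'b) monoid_scheme \<Rightarrow> nat set set" where
  "length_system G = length_set G ` carrier G"

definition set_distances :: "int set \<Rightarrow> nat set" where
  "set_distances L =
     {d. 1 \<le> d \<and> (\<exists>k\<in>L. \<exists>l\<in>L. l - k = int d \<and> {k..l} \<inter> L = {k, l})}"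

definition distances :: "('a, 'b) monoid_scheme \<Rightarrow> nat set" where
  "distances G = (\<Union>L\<in>length_system G. set_distances (int ` L))"

text \<open>Only meaningful for nonempty \<open>L\<close>; the infimum of a nonempty set of naturals is its minimum.\<close>

definition set_elasticity :: "nat set \<Rightarrow> ereal" where
  "set_elasticity L =
     (if L = {0} then 1 else (SUP l\<in>L. ereal (real l)) / ereal (real (Inf L)))"

definition elasticity :: "('a, 'b) monoid_scheme \<Rightarrow> ereal" where
  "elasticity G = (SUP L\<in>length_system G. set_elasticity L)"

text \<open>Only meaningful for \<open>k \<ge> 1\<close>.\<close>

definition length_union :: "('a, 'b) monoid_scheme \<Rightarrow> nat \<Rightarrow> nat set" where
  "length_union G k =
     (if carrier G = Units G then {k}
      else {l. 1 \<le> l \<and> (\<exists>us vs. length us = k \<and> length vs = l \<and>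
              set us \<subseteq> atoms G \<and> set vs \<subseteq> atoms G \<and> list_product G us = list_product G vs)})"

definition elasticity_k :: "('a, 'b) monoid_scheme \<Rightarrow> nat \<Rightarrow> enat" where
  "elasticity_k G k = (SUP l\<in>length_union G k. enat l)"

text \<open>
  Nonempty progressions that have a least element; \<open>N\<close> is the number of steps, with \<open>N = \<infinity>\<close>
  giving the infinite progressions and \<open>N = 0\<close> the singletons.
\<close>

definition arith_progression :: "nat \<Rightarrow> int set \<Rightarrow> bool" where
  "arith_progression d A \<longleftrightarrow>
     (\<exists>(a::int) (N::enat). A = {a + int d * int i | i. enat i \<le> N})"

definition almost_arith_progression :: "nat \<Rightarrow> nat \<Rightarrow> int set \<Rightarrow> bool" where
  "almost_arith_progression d M L \<longleftrightarrow>
     (\<exists>(y::int) L' Ls L''.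
        L = (+) y ` (L' \<union> Ls \<union> L'') \<and>
        L \<subseteq> {y + int d * z | z. True} \<and>
        arith_progression d Ls \<and> 0 \<in> Ls \<and> (\<forall>x\<in>Ls. 0 \<le> x) \<and>
        L' \<subseteq> {- int M .. -1} \<and>
        (if finite Ls then L'' \<subseteq> (+) (Max Ls) ` {1 .. int M} else L'' = {}))"

text \<open>\<^const>\<open>card\<close> of an infinite set is 0, hence a cardinality with values in \<^typ>\<open>enat\<close>.\<close>

definition ecard :: "'a set \<Rightarrow> enat" where
  "ecard A = (if finite A then enat (card A) else \<infinity>)"

end

theory Submission
  imports Defs
begin

text \<open>
  Write \<open>U k\<close> for the union of the sets of lengths containing \<open>k\<close>. Concatenation of factorizations
  gives \<open>U k + U l \<subseteq> U (k + l)\<close>, and \<open>l \<in> U k\<close> iff \<open>k \<in> U l\<close>. All elements of \<open>U k\<close> are congruent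
  modulo \<open>d\<close>, the gaps of \<open>U k\<close> are bounded by the largest distance, and a power of an element with
  lengths \<open>x\<close>, \<open>x + d\<close> has lengths forming a long progression \<open>m, m + d, \<dots>\<close>. Adding this progression to
  \<open>U (k - m)\<close> fills all gaps, so \<open>U k\<close> contains its full residue class between \<open>min U (k - m) + m\<close>
  and \<open>sup U (k - m) + m\<close>. The upper end is close to \<open>sup U k\<close> by the hypothesis on \<open>\<rho>\<^sub>k\<close>; the lower
  end is close to \<open>min U k\<close> by symmetry, without further hypotheses. Hence \<open>d |U k|\<close> is
  \<open>max U k - min U k\<close> up to a constant, and superadditivity of \<open>max U k\<close> and subadditivity of
  \<open>min U k\<close> give \<open>max U k / k \<rightarrow> \<rho>\<close> and \<open>min U k / k \<rightarrow> 1 / \<rho>\<close>.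
\<close>

subsection \<open>Almost arithmetical progressions\<close>

lemma real_div_nat_lower:
  fixes k n :: nat
  assumes "0 < n"
  shows "real k / real n - 1 \<le> real (k div n)"
proof -
  have "k < n * (k div n) + n" using dividend_less_times_div[OF assms, of k] by (simp add: add.commute)
  then have "real k \<le> real n * real (k div n) + real n"
    by (metis of_nat_add of_nat_mult of_nat_mono less_imp_le)
  then show ?thesis using assms by (simp add: field_simps)
qed

lemma enumerate_residue_class:
  fixes d t y :: nat
  assumes "0 < d" "t mod d = y mod d" "y \<le> t" "t \<le> z"
  obtains i where "t = y + d * i" "i \<le> (z - y) div d"
proof -
  have "d dvd t - y" using assms mod_eq_dvd_iff_nat by blast
  then obtain i where i: "t - y = d * i" by (elim dvdE)
  then have "i = (t - y) div d" using assms(1) by simp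
  then have "i \<le> (z - y) div d" using assms(4) by (simp add: div_le_mono)
  moreover have "t = y + d * i" using i assms(3) by simp
  ultimately show ?thesis using that by blast
qed

lemma int_image_residue_class:
  assumes res: "\<And>t. t \<in> A \<Longrightarrow> t mod d = y mod d"
  shows "int ` A \<subseteq> {int y + int d * w | w. True}"
proof
  fix x assume "x \<in> int ` A"
  then obtain t where t: "t \<in> A" "x = int t" by auto
  have "int t mod int d = int y mod int d" using res[OF t(1)] by (metis zmod_int)
  then have "int d dvd int t - int y" by (simp add: mod_eq_dvd_iff)
  then obtain w where "int t - int y = int d * w" by (elim dvdE)
  then have "x = int y + int d * w" using t by simp
  then show "x \<in> {int y + int d * w | w. True}" by blast
qed

text \<open>The members of the residue class in \<open>[y, z]\<close> form the central progression,
  and the rest of \<open>A\<close> lies within \<open>M\<close> of one of its ends and splits into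
  the two fringes \<open>B\<close> and \<open>C\<close>. The bounds are stated additively to avoid
  truncated subtraction.\<close>

lemma almost_arith_progression_finiteI:
  fixes A :: "nat set"
  assumes d: "0 < d" and res: "\<And>t. t \<in> A \<Longrightarrow> t mod d = y mod d" and z: "z mod d = y mod d" "y \<le> z"
    and lo: "\<And>t. t \<in> A \<Longrightarrow> y \<le> t + M" and hi: "\<And>t. t \<in> A \<Longrightarrow> t \<le> z + M"
    and full: "\<And>t. t mod d = y mod d \<Longrightarrow> y \<le> t \<Longrightarrow> t \<le> z \<Longrightarrow> t \<in> A"
  shows "almost_arith_progression d M (int ` A)"
proof -
  obtain N where N: "z = y + d * N" using enumerate_residue_class[OF d z(1,2) order_refl] by metis
  define Ls where "Ls = {0 + int d * int i | i. enat i \<le> enat N}"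
  define B where "B = (\<lambda>t. int t - int y) ` {t \<in> A. t < y}"
  define C where "C = (\<lambda>t. int t - int y) ` {t \<in> A. z < t}"
  have Ls: "Ls = (\<lambda>i. int d * int i) ` {..N}" unfolding Ls_def by auto
  have fin: "finite Ls" unfolding Ls by simp
  have "Max Ls = int d * int N"
    by (rule Max_eqI) (use d in \<open>auto simp: Ls\<close>)
  then have Max: "Max Ls = int z - int y" using N by simp
  have eq: "int ` A = (+) (int y) ` (B \<union> Ls \<union> C)"
  proof (intro equalityI subsetI)
    fix x assume "x \<in> int ` A"
    then obtain t where t: "t \<in> A" "x = int t" by auto
    show "x \<in> (+) (int y) ` (B \<union> Ls \<union> C)"
    proof (cases "y \<le> t \<and> t \<le> z")
      case True
      then obtain i where "t = y + d * i" "i \<le> (z - y) div d"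
        using enumerate_residue_class[OF d res[OF t(1)]] by metis
      then have "int t - int y \<in> Ls" using N d unfolding Ls by auto
      then show ?thesis using t by force
    next
      case False
      then have "int t - int y \<in> B \<union> C" using t unfolding B_def C_def by auto
      then show ?thesis using t by force
    qed
  next
    fix x assume "x \<in> (+) (int y) ` (B \<union> Ls \<union> C)"
    then obtain w where w: "w \<in> B \<union> Ls \<union> C" "x = int y + w" by auto
    show "x \<in> int ` A"
    proof (cases "w \<in> Ls")
      case True
      then obtain i where i: "i \<le> N" "w = int d * int i" unfolding Ls by auto
      have "y + d * i \<in> A" by (rule full) (use i N in auto)
      then have "int (y + d * i) \<in> int ` A" by blast
      then show ?thesis using i w by simp
    next
      case False
      then show ?thesis using w unfolding B_def C_def by auto
    qed
  qed
  have "int ` A \<subseteq> {int y + int d * w | w. True}"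
    using res by (rule int_image_residue_class)
  moreover have "arith_progression d Ls" unfolding arith_progression_def Ls_def by blast
  moreover have "0 \<in> Ls" "\<forall>x\<in>Ls. 0 \<le> x" unfolding Ls by auto
  moreover have "B \<subseteq> {- int M .. -1}" unfolding B_def using lo by fastforce
  moreover have "C \<subseteq> (+) (Max Ls) ` {1 .. int M}"
  proof
    fix x assume "x \<in> C"
    then obtain t where t: "t \<in> A" "z < t" "x = int t - int y" unfolding C_def by auto
    then have "x = Max Ls + (int t - int z)" "int t - int z \<in> {1..int M}"
      using hi[OF t(1)] Max by auto
    then show "x \<in> (+) (Max Ls) ` {1 .. int M}" by blast
  qed
  ultimately show ?thesis
    unfolding almost_arith_progression_def using eq fin
    by (intro exI[of _ "int y"] exI[of _ B] exI[of _ Ls] exI[of _ C]) simp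
qed

text \<open>The analogue with an unbounded central progression, so that only the lower fringe
  \<open>B\<close> remains.\<close>

lemma almost_arith_progression_infiniteI:
  fixes A :: "nat set"
  assumes d: "0 < d" and res: "\<And>t. t \<in> A \<Longrightarrow> t mod d = y mod d"
    and lo: "\<And>t. t \<in> A \<Longrightarrow> y \<le> t + M"
    and full: "\<And>t. t mod d = y mod d \<Longrightarrow> y \<le> t \<Longrightarrow> t \<in> A"
  shows "almost_arith_progression d M (int ` A)"
proof -
  define Ls where "Ls = {0 + int d * int i | i. enat i \<le> \<infinity>}"
  define B where "B = (\<lambda>t. int t - int y) ` {t \<in> A. t < y}"
  have Ls: "Ls = range (\<lambda>i. int d * int i)" unfolding Ls_def by auto
  have "inj (\<lambda>i. int d * int i)" using d by (auto simp: inj_on_def)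
  then have inf: "infinite Ls" unfolding Ls using finite_imageD infinite_UNIV_nat by blast
  have eq: "int ` A = (+) (int y) ` (B \<union> Ls \<union> {})"
  proof (intro equalityI subsetI)
    fix x assume "x \<in> int ` A"
    then obtain t where t: "t \<in> A" "x = int t" by auto
    show "x \<in> (+) (int y) ` (B \<union> Ls \<union> {})"
    proof (cases "y \<le> t")
      case True
      then obtain i where "t = y + d * i"
        using enumerate_residue_class[OF d res[OF t(1)] _ order_refl] by metis
      then have "int t - int y \<in> Ls" unfolding Ls by auto
      then show ?thesis using t by force
    next
      case False
      then have "int t - int y \<in> B" using t unfolding B_def by auto
      then show ?thesis using t by force
    qed
  next
    fix x assume "x \<in> (+) (int y) ` (B \<union> Ls \<union> {})"
    then obtain w where w: "w \<in> B \<union> Ls" "x = int y + w" by auto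
    show "x \<in> int ` A"
    proof (cases "w \<in> Ls")
      case True
      then obtain i where i: "w = int d * int i" unfolding Ls by auto
      have "y + d * i \<in> A" by (rule full) auto
      then have "int (y + d * i) \<in> int ` A" by blast
      then show ?thesis using i w by simp
    next
      case False
      then show ?thesis using w unfolding B_def by auto
    qed
  qed
  have "int ` A \<subseteq> {int y + int d * w | w. True}"
    using res by (rule int_image_residue_class)
  moreover have "arith_progression d Ls" unfolding arith_progression_def Ls_def by blast
  moreover have "0 \<in> Ls" "\<forall>x\<in>Ls. 0 \<le> x" unfolding Ls by auto
  moreover have "B \<subseteq> {- int M .. -1}" unfolding B_def using lo by fastforce
  ultimately show ?thesis
    unfolding almost_arith_progression_def using eq inf
    by (intro exI[of _ "int y"] exI[of _ B] exI[of _ Ls] exI[of _ "{}"]) simp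
qed

subsection \<open>Symmetric additive families of sets of lengths\<close>

locale length_relation =
  fixes U :: "nat \<Rightarrow> nat set"
  assumes zero: "U 0 = {0}"
    and self_mem: "k \<in> U k"
    and mem_sym: "l \<in> U k \<Longrightarrow> k \<in> U l"
    and mem_add: "l \<in> U k \<Longrightarrow> l' \<in> U k' \<Longrightarrow> l + l' \<in> U (k + k')"
begin

lemma pos: "l \<in> U k \<Longrightarrow> 0 < k \<Longrightarrow> 0 < l"
  by (metis mem_sym zero singletonD gr0I)

lemma mult: "l \<in> U k \<Longrightarrow> n * l \<in> U (n * k)"
proof (induction n)
  case 0
  show ?case using zero by simp
next
  case (Suc n)
  then show ?case using mem_add[OF Suc.prems Suc.IH[OF Suc.prems]] by simp
qed

end

text \<open>In the application \<open>d\<close> is the least and \<open>D\<close> the largest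
  distance, and \<open>x\<close>, \<open>x + d\<close> are two lengths of one element. Thus
  \<open>step\<close> is the source of all changes of length by exactly \<open>d\<close>.\<close>

locale length_unions = length_relation +
  fixes d D x :: nat
  assumes d_pos: "0 < d"
    and residue: "l \<in> U k \<Longrightarrow> l mod d = k mod d"
    and gap: "i \<in> U k \<Longrightarrow> j \<in> U k \<Longrightarrow> i < j \<Longrightarrow> \<exists>i'\<in>U k. i < i' \<and> i' \<le> i + D"
    and step: "x + d \<in> U x"
    and D_pos: "0 < D" and x_pos: "0 < x"
begin

lemma Inf_mem: "Inf (U k) \<in> U k"
  using self_mem by (metis Inf_nat_def1 empty_iff)

lemma Inf_le: "l \<in> U k \<Longrightarrow> Inf (U k) \<le> l"
  by (rule wellorder_Inf_le1)

text \<open>The shortest of the lengths \<open>m\<close>, \<open>m + d\<close>, ...,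
  \<open>m + d * D\<close> that arise from \<open>D\<close> copies of the relation
  \<open>step\<close>. It is the amount by which indices are shifted below.\<close>

definition m :: nat where "m = D * x"

lemma m_pos: "0 < m"
  using D_pos x_pos unfolding m_def by simp

text \<open>Of the \<open>D\<close> copies of \<open>x\<close>, exactly \<open>i\<close> are
  replaced by \<open>x + d\<close> and the others are kept.\<close>

lemma progression: "i \<le> D \<Longrightarrow> m + d * i \<in> U m"
proof -
  assume i: "i \<le> D"
  have "i * (x + d) + (D - i) * x \<in> U (i * x + (D - i) * x)"
    by (intro mem_add mult step self_mem)
  moreover have "i * x + (D - i) * x = m" using i unfolding m_def
    by (metis add_mult_distrib le_add_diff_inverse)
  moreover have "i * (x + d) + (D - i) * x = (i * x + (D - i) * x) + d * i"
    by (simp add: algebra_simps)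
  ultimately show ?thesis by metis
qed

lemma gap_below:
  assumes "a \<in> U k" "b \<in> U k" "a \<le> t" "t \<le> b"
  obtains j where "j \<in> U k" "j \<le> t" "t < j + D"
proof -
  define j where "j = Max {j \<in> U k. j \<le> t}"
  have fin: "finite {j \<in> U k. j \<le> t}" by simp
  have ne: "{j \<in> U k. j \<le> t} \<noteq> {}" using assms by auto
  have j: "j \<in> U k" "j \<le> t" using Max_in[OF fin ne] unfolding j_def by auto
  have "t < j + D"
  proof (cases "j = b")
    case True
    then show ?thesis using D_pos assms j by simp
  next
    case False
    then obtain i where i: "i \<in> U k" "j < i" "i \<le> j + D"
      using gap[OF j(1) assms(2)] j assms by auto
    have "t < i"
    proof (rule ccontr)
      assume "\<not> t < i"
      then have "i \<le> j" unfolding j_def using i fin by (intro Max_ge) auto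
      then show False using i by simp
    qed
    then show ?thesis using i by simp
  qed
  then show ?thesis using j that by blast
qed

text \<open>Some \<open>j\<close> in \<open>U (k - m)\<close> lies less than \<open>D\<close> below
  \<open>t - m\<close>. The remaining difference is a multiple of \<open>d\<close>, and a member of
  the progression in \<open>U m\<close> supplies it.\<close>

lemma filled:
  assumes "m \<le> k" "a \<in> U (k - m)" "b \<in> U (k - m)" "a + m \<le> t" "t \<le> b + m" "t mod d = k mod d"
  shows "t \<in> U k"
proof -
  obtain j where j: "j \<in> U (k - m)" "j \<le> t - m" "t - m < j + D"
    using gap_below[OF assms(2,3), of "t - m"] assms(4,5)
    by (metis le_diff_conv le_diff_conv2 add_leD2 le_trans)
  have "(j + m) mod d = (k - m + m) mod d" using residue[OF j(1)] by (metis mod_add_left_eq)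
  then have "(j + m) mod d = t mod d" using assms by simp
  then have "d dvd t - (j + m)" using mod_eq_dvd_iff_nat[of "j + m" t d] j assms by simp
  then obtain i where i: "t - (j + m) = d * i" by (elim dvdE)
  \<comment> \<open>The progression has \<open>D\<close> steps, which is enough:
    \<open>i \<le> d * i = t - (j + m) < D\<close>.\<close>
  have "i \<le> d * i" using d_pos by simp
  then have "i \<le> D" using i j by linarith
  then have "j + (m + d * i) \<in> U (k - m + m)" using j progression mem_add by blast
  moreover have "j + (m + d * i) = t" using i j(2) assms(4) by simp
  ultimately show ?thesis using assms(1) by simp
qed

text \<open>Symmetry turns the search for a small element of \<open>U (k - m)\<close> into showing
  that \<open>k - m\<close> lies in some \<open>U n\<close> with \<open>n\<close> small. With
  \<open>l = Inf (U k)\<close>, the relation \<open>k \<in> U l\<close> makes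
  \<open>U (l + s)\<close> reach from \<open>l + s\<close> up to \<open>k + s\<close>, and
  \<open>filled\<close> then puts \<open>k - m\<close> into \<open>U (l + s + m)\<close>.\<close>

lemma Inf_shift:
  assumes "m \<le> k"
  shows "Inf (U (k - m)) \<le> Inf (U k) + 2 * m * d"
proof -
  define l where "l = Inf (U k)"
  \<comment> \<open>With this choice \<open>l + s + 2 * m = l + 2 * m * d\<close> is congruent to
    \<open>l\<close>, hence to \<open>k\<close>, modulo \<open>d\<close>, so \<open>k - m\<close>
    and \<open>l + s + m\<close> are congruent as \<open>filled\<close> requires. The subtraction
    does not truncate since \<open>d \<ge> 1\<close>.\<close>
  define s where "s = 2 * m * d - 2 * m"
  have md: "2 * m \<le> 2 * m * d" using d_pos by simp
  have l: "k \<in> U l" unfolding l_def by (rule mem_sym, rule Inf_mem)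
  show ?thesis
  proof (cases "l + 2 * m * d \<le> k")
    case True
    have b: "k + s \<in> U (l + s)" using l self_mem mem_add by blast
    have le: "l + s + m \<le> k - m" using True md unfolding s_def by linarith
    have "k mod d = l mod d" using residue l by blast
    then have "k mod d = (l + 2 * m * d) mod d" by simp
    then have "d dvd k - (l + 2 * m * d)" using mod_eq_dvd_iff_nat True by blast
    moreover have "k - (l + 2 * m * d) = (k - m) - (l + s + m)" using md s_def by linarith
    ultimately have res: "(k - m) mod d = (l + s + m) mod d"
      using mod_eq_dvd_iff_nat[OF le, of d] by simp
    have "k - m \<in> U (l + s + m)"
    proof (rule filled)
      show "l + s \<in> U (l + s + m - m)" "k + s \<in> U (l + s + m - m)"
        using self_mem b by simp_all
    qed (use le res in simp_all)
    then have "Inf (U (k - m)) \<le> l + s + m" using mem_sym Inf_le by blast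
    then show ?thesis using md unfolding l_def[symmetric] s_def by linarith
  next
    case False
    have "Inf (U (k - m)) \<le> k - m" using self_mem Inf_le by blast
    then show ?thesis using False unfolding l_def by linarith
  qed
qed

text \<open>As \<open>U (k - m)\<close> is unbounded, \<open>filled\<close> applies to every
  \<open>t\<close> of the residue class from \<open>Inf (U (k - m)) + m\<close> on.
  \<open>Inf_shift\<close> bounds the fringe below that point.\<close>

lemma almost_arith_progression_infinite:
  assumes "infinite (U (k - m))" "m \<le> k"
  shows "almost_arith_progression d (m + 2 * m * d) (int ` U k)"
proof (rule almost_arith_progression_infiniteI[where y = "Inf (U (k - m)) + m"])
  have "(Inf (U (k - m)) + m) mod d = (k - m + m) mod d"
    using residue[OF Inf_mem] by (metis mod_add_left_eq)
  then have y: "(Inf (U (k - m)) + m) mod d = k mod d" using assms by simp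
  show "0 < d" by (rule d_pos)
  show "t mod d = (Inf (U (k - m)) + m) mod d" if "t \<in> U k" for t using y residue that by simp
  show "Inf (U (k - m)) + m \<le> t + (m + 2 * m * d)" if "t \<in> U k" for t
    using Inf_shift[OF assms(2)] Inf_le[OF that] by simp
  show "t \<in> U k" if t: "t mod d = (Inf (U (k - m)) + m) mod d" "Inf (U (k - m)) + m \<le> t" for t
  proof -
    obtain b where "b \<in> U (k - m)" "t \<le> b"
      using assms(1) by (meson finite_nat_set_iff_bounded_le nat_le_linear)
    then show ?thesis using filled[OF assms(2) Inf_mem, of b t] t y by simp
  qed
qed

lemma infinite_mono:
  assumes "infinite (U k)" "k \<le> k'"
  shows "infinite (U k')"
proof -
  have "(\<lambda>l. l + (k' - k)) ` U k \<subseteq> U k'"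
    using mem_add[OF _ self_mem[of "k' - k"]] assms(2) by (metis image_subsetI le_add_diff_inverse)
  moreover have "infinite ((\<lambda>l. l + (k' - k)) ` U k)"
    using assms(1) by (simp add: finite_image_iff)
  ultimately show ?thesis using finite_subset by blast
qed

end

section \<open>Finite unions of sets of lengths: structure and cardinality\<close>

locale finite_length_unions = length_unions +
  fixes M :: nat
  assumes finite_union: "finite (U k)"
    and Max_Suc: "Max (U (Suc k)) \<le> Max (U k) + M"
begin

lemma Max_mem: "Max (U k) \<in> U k"
  using finite_union self_mem by (metis Max_in empty_iff)

lemma le_Max: "l \<in> U k \<Longrightarrow> l \<le> Max (U k)"
  using finite_union by simp

lemma Inf_le_Max: "Inf (U k) \<le> Max (U k)"
  using Inf_mem le_Max by blast

lemma Max_add: "Max (U (k + n)) \<le> Max (U k) + n * M"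
proof (induction n)
  case (Suc n)
  then show ?case using Max_Suc[of "k + n"] by simp
qed simp

lemma Max_le: "Max (U k) \<le> k * M"
  using Max_add[of 0 k] zero by simp

lemma filled_interval:
  assumes "m \<le> k" "Inf (U (k - m)) + m \<le> t" "t \<le> Max (U (k - m)) + m"
    "t mod d = (Inf (U (k - m)) + m) mod d"
  shows "t \<in> U k"
proof -
  have "(Inf (U (k - m)) + m) mod d = (k - m + m) mod d"
    using residue[OF Inf_mem] by (metis mod_add_left_eq)
  then show ?thesis using filled[OF assms(1) Inf_mem Max_mem assms(2,3)] assms by simp
qed

text \<open>The class is full between \<open>Inf (U (k - m)) + m\<close> and
  \<open>Max (U (k - m)) + m\<close>. \<open>Inf_shift\<close> controls the lower fringe and
  \<open>Max_add\<close> the upper one.\<close>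

lemma almost_arith_progression_finite:
  "almost_arith_progression d (m + 2 * m * d + m * M) (int ` U k)"
proof (cases "m \<le> k")
  case True
  show ?thesis
  proof (rule almost_arith_progression_finiteI
      [where y = "Inf (U (k - m)) + m" and z = "Max (U (k - m)) + m"])
    have y: "(l + m) mod d = k mod d" if "l \<in> U (k - m)" for l
    proof -
      have "(l + m) mod d = (k - m + m) mod d"
        using residue[OF that] by (metis mod_add_left_eq)
      then show ?thesis using True by simp
    qed
    show "0 < d" by (rule d_pos)
    show "t mod d = (Inf (U (k - m)) + m) mod d" if "t \<in> U k" for t
      using y[OF Inf_mem] residue that by simp
    show "Inf (U (k - m)) + m \<le> t + (m + 2 * m * d + m * M)" if "t \<in> U k" for t
      using Inf_shift[OF True] Inf_le[OF that] by simp
    show "t \<le> Max (U (k - m)) + m + (m + 2 * m * d + m * M)" if "t \<in> U k" for t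
      using Max_add[of "k - m" m] le_Max[OF that] True by simp
    show "(Max (U (k - m)) + m) mod d = (Inf (U (k - m)) + m) mod d"
      using y Inf_mem Max_mem by simp
    show "Inf (U (k - m)) + m \<le> Max (U (k - m)) + m" using Inf_le_Max by simp
  qed (use filled_interval[OF True] in simp)
next
  case False
  show ?thesis
  \<comment> \<open>Below \<open>m\<close> no shift is possible, but \<open>U k\<close> is then
    contained in \<open>[0, m * M]\<close>, and the singleton \<open>{k}\<close> serves as the
    central progression.\<close>
  proof (rule almost_arith_progression_finiteI[where y = k and z = k])
    show "t \<le> k + (m + 2 * m * d + m * M)" if "t \<in> U k" for t
    proof -
      have "t \<le> k * M" using le_Max[OF that] Max_le[of k] by simp
      also have "\<dots> \<le> m * M" using False by simp
      finally show ?thesis by simp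
    qed
  qed (use d_pos residue self_mem False in \<open>auto\<close>)
qed

text \<open>\<open>U k\<close> lies in one residue class modulo \<open>d\<close> between its minimum
  and its maximum.\<close>

lemma card_upper: "d * card (U k) + Inf (U k) \<le> Max (U k) + d"
proof -
  have "U k \<subseteq> (\<lambda>i. Inf (U k) + d * i) ` {..(Max (U k) - Inf (U k)) div d}"
  proof
    fix t assume t: "t \<in> U k"
    have "t mod d = Inf (U k) mod d" using residue[OF t] residue[OF Inf_mem] by simp
    then obtain i where "t = Inf (U k) + d * i" "i \<le> (Max (U k) - Inf (U k)) div d"
      using enumerate_residue_class[OF d_pos _ Inf_le[OF t] le_Max[OF t]] by metis
    then show "t \<in> (\<lambda>i. Inf (U k) + d * i) ` {..(Max (U k) - Inf (U k)) div d}" by blast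
  qed
  then have "card (U k) \<le> card {..(Max (U k) - Inf (U k)) div d}"
    by (meson finite_atMost surj_card_le)
  then have "d * card (U k) \<le> d * ((Max (U k) - Inf (U k)) div d) + d"
    by (metis card_atMost mult_le_mono2 mult_Suc_right add.commute)
  also have "\<dots> \<le> (Max (U k) - Inf (U k)) + d" by simp
  finally show ?thesis using Inf_le_Max[of k] by simp
qed

text \<open>\<open>U k\<close> contains every member of its class in the interval given by
  \<open>filled_interval\<close>. The length of that interval falls short of
  \<open>Max (U k) - Inf (U k)\<close> by at most \<open>m * M + 2 * m * d\<close>.\<close>

lemma card_lower:
  assumes "m \<le> k"
  shows "Max (U k) \<le> d * card (U k) + Inf (U k) + (m * M + 2 * m * d)"
proof -
  define y z where "y = Inf (U (k - m))" and "z = Max (U (k - m))"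
  have yz: "y \<le> z" unfolding y_def z_def by (rule Inf_le_Max)
  define f where "f = (\<lambda>i. y + m + d * i)"
  have "f ` {..(z - y) div d} \<subseteq> U k"
  proof
    fix t assume "t \<in> f ` {..(z - y) div d}"
    then obtain i where i: "i \<le> (z - y) div d" "t = y + m + d * i" unfolding f_def by auto
    have "d * i \<le> z - y" using i(1) d_pos by (simp add: less_eq_div_iff_mult_less_eq mult.commute)
    then show "t \<in> U k" using filled_interval[OF assms, folded y_def z_def, of t] i(2) yz by simp
  qed
  then have "card (f ` {..(z - y) div d}) \<le> card (U k)" using finite_union by (simp add: card_mono)
  moreover have "inj_on f {..(z - y) div d}" using d_pos unfolding f_def inj_on_def by simp
  ultimately have "(z - y) div d + 1 \<le> card (U k)" by (simp add: card_image)
  then have "d * ((z - y) div d + 1) \<le> d * card (U k)" using mult_le_mono2 by blast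
  moreover have "z - y \<le> d * ((z - y) div d + 1)"
    using d_pos by (simp add: dividend_less_times_div less_imp_le)
  ultimately have "z \<le> d * card (U k) + y" by simp
  moreover have "Max (U k) \<le> z + m * M"
    using Max_add[of "k - m" m] assms unfolding z_def by simp
  moreover have "y \<le> Inf (U k) + 2 * m * d" using Inf_shift[OF assms] unfolding y_def by simp
  ultimately show ?thesis by simp
qed

section \<open>Limits along \<open>k\<close>, where \<open>R\<close> is the supremum of the
  quotients \<open>l / k\<close> with \<open>l \<in> U k\<close> and \<open>k > 0\<close>\<close>

context
  fixes R :: real
  assumes upper: "l \<in> U k \<Longrightarrow> real l \<le> R * real k"
    and approx: "c < R \<Longrightarrow> \<exists>k l. 0 < k \<and> l \<in> U k \<and> c < real l / real k"
begin

lemma R_ge_1: "1 \<le> R"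
  using upper[OF self_mem[of 1]] by simp

text \<open>Division with remainder splits \<open>k\<close> into \<open>k div n\<close> blocks of
  size \<open>n\<close>, each exchanged for \<open>l\<close>, and a remainder that is kept. This is
  how a single good pair \<open>(n, l)\<close> influences all large \<open>k\<close>.\<close>

lemma quotient_mem: "l \<in> U n \<Longrightarrow> (k div n) * l + k mod n \<in> U k"
  using mem_add[OF mult self_mem, of l n "k div n" "k mod n"] by simp

text \<open>An argument as in Fekete's lemma: a pair with \<open>l / n > a\<close> yields
  \<open>Max (U k) / k \<ge> l / n - l / k\<close> for all \<open>k > 0\<close>, while
  \<open>upper\<close> bounds the quotients by \<open>R\<close>.\<close>

lemma Max_tendsto: "(\<lambda>k. real (Max (U k)) / real k) \<longlonglongrightarrow> R"
proof (rule order_tendstoI)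
  fix a assume "a < R"
  then obtain n l where n: "0 < n" "l \<in> U n" "a < real l / real n" using approx by blast
  have "(\<lambda>k. real l / real n - real l / real k) \<longlonglongrightarrow> real l / real n - 0"
    by (intro tendsto_intros lim_const_over_n)
  then have "\<forall>\<^sub>F k in sequentially. a < real l / real n - real l / real k"
    using n(3) by (intro order_tendstoD(1)) auto
  then show "\<forall>\<^sub>F k in sequentially. a < real (Max (U k)) / real k"
    using eventually_gt_at_top[of 0]
  proof eventually_elim
    case (elim k)
    have "(real k / real n - 1) * real l \<le> real (k div n) * real l"
      using real_div_nat_lower[OF n(1)] by (intro mult_right_mono) auto
    also have "\<dots> \<le> real ((k div n) * l + k mod n)" by simp
    also have "\<dots> \<le> real (Max (U k))" by (rule of_nat_mono[OF le_Max[OF quotient_mem[OF n(2)]]])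
    finally have "(real k / real n - 1) * real l / real k \<le> real (Max (U k)) / real k"
      by (simp add: divide_right_mono)
    moreover have "(real k / real n - 1) * real l / real k = real l / real n - real l / real k"
      using elim n by (simp add: field_simps)
    ultimately show ?case using elim by linarith
  qed
next
  fix a assume a: "R < a"
  show "\<forall>\<^sub>F k in sequentially. real (Max (U k)) / real k < a"
    using eventually_gt_at_top[of 0]
  proof eventually_elim
    case (elim k)
    have "real (Max (U k)) / real k \<le> R" using upper[OF Max_mem] elim by (simp add: field_simps)
    then show ?case using a by simp
  qed
qed

text \<open>Both bounds come from reading relations backwards: \<open>k \<in> U (Inf (U k))\<close>
  gives \<open>k \<le> R * Inf (U k)\<close>, and a pair \<open>p \<in> U n\<close> with
  \<open>p / n\<close> close to \<open>R\<close> gives \<open>n \<in> U p\<close> with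
  \<open>n / p\<close> close to \<open>1 / R\<close>.\<close>

lemma Inf_tendsto: "(\<lambda>k. real (Inf (U k)) / real k) \<longlonglongrightarrow> 1 / R"
proof (rule order_tendstoI)
  fix a assume a: "a < 1 / R"
  show "\<forall>\<^sub>F k in sequentially. a < real (Inf (U k)) / real k"
    using eventually_gt_at_top[of 0]
  proof eventually_elim
    case (elim k)
    have "real k \<le> R * real (Inf (U k))" using upper[OF mem_sym[OF Inf_mem]] .
    then have "1 / R \<le> real (Inf (U k)) / real k" using elim R_ge_1 by (simp add: field_simps)
    then show ?case using a by simp
  qed
next
  fix a assume a: "1 / R < a"
  moreover have "0 < 1 / R" using R_ge_1 by simp
  ultimately have a0: "0 < a" by linarith
  have "1 / a < R" using a a0 R_ge_1 by (simp add: field_simps)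
  then obtain n p where n: "0 < n" "p \<in> U n" "1 / a < real p / real n" using approx by blast
  have p: "0 < p" using pos n by blast
  have "(\<lambda>k. real n / real p + real p / real k) \<longlonglongrightarrow> real n / real p + 0"
    by (intro tendsto_intros lim_const_over_n)
  moreover have "real n / real p < a" using n a0 p by (simp add: field_simps)
  ultimately have "\<forall>\<^sub>F k in sequentially. real n / real p + real p / real k < a"
    by (intro order_tendstoD(2)) auto
  then show "\<forall>\<^sub>F k in sequentially. real (Inf (U k)) / real k < a"
    using eventually_gt_at_top[of 0]
  proof eventually_elim
    case (elim k)
    have "Inf (U k) \<le> (k div p) * n + k mod p"
      by (rule Inf_le, rule quotient_mem, rule mem_sym, rule n)
    then have "real (Inf (U k)) \<le> real ((k div p) * n + k mod p)" by (rule of_nat_mono)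
    also have "\<dots> \<le> real k / real p * real n + real p"
    proof -
      have "real (k div p) \<le> real k / real p" by (rule of_nat_div_le_of_nat)
      then have "real (k div p) * real n \<le> real k / real p * real n" by (intro mult_right_mono) auto
      moreover have "real (k mod p) \<le> real p" using p by (simp add: less_imp_le)
      ultimately show ?thesis by simp
    qed
    finally have "real (Inf (U k)) / real k \<le> (real k / real p * real n + real p) / real k"
      by (simp add: divide_right_mono)
    moreover have "(real k / real p * real n + real p) / real k = real n / real p + real p / real k"
      using elim p by (simp add: field_simps)
    ultimately show ?case using elim by linarith
  qed
qed

text \<open>By \<open>card_upper\<close> and \<open>card_lower\<close>,
  \<open>d * card (U k)\<close> equals \<open>Max (U k) - Inf (U k)\<close> up to a constant, which
  vanishes after division by \<open>k\<close>.\<close>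

lemma card_tendsto: "(\<lambda>k. real (card (U k)) / real k) \<longlonglongrightarrow> 1 / real d * (R - 1 / R)"
proof (rule tendsto_sandwich)
  define C where "C = real (m * M + 2 * m * d)"
  define g where "g = (\<lambda>k. real (Max (U k)) / real k - real (Inf (U k)) / real k)"
  have g: "g \<longlonglongrightarrow> R - 1 / R" unfolding g_def by (intro tendsto_diff Max_tendsto Inf_tendsto)
  have "(\<lambda>k. 1 / real d * (g k - C / real k)) \<longlonglongrightarrow> 1 / real d * (R - 1 / R - 0)"
    by (intro tendsto_intros g lim_const_over_n)
  then show "(\<lambda>k. 1 / real d * (g k - C / real k)) \<longlonglongrightarrow> 1 / real d * (R - 1 / R)" by simp
  have "(\<lambda>k. 1 / real d * (g k + real d / real k)) \<longlonglongrightarrow> 1 / real d * (R - 1 / R + 0)"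
    by (intro tendsto_intros g lim_const_over_n)
  then show "(\<lambda>k. 1 / real d * (g k + real d / real k)) \<longlonglongrightarrow> 1 / real d * (R - 1 / R)" by simp
  show "\<forall>\<^sub>F k in sequentially. 1 / real d * (g k - C / real k) \<le> real (card (U k)) / real k"
    using eventually_gt_at_top[of 0] eventually_ge_at_top[of m]
  proof eventually_elim
    case (elim k)
    have "real (Max (U k)) \<le> real (d * card (U k) + Inf (U k) + (m * M + 2 * m * d))"
      using card_lower[OF elim(2)] of_nat_mono by blast
    then have "real (Max (U k)) - real (Inf (U k)) - C \<le> real d * real (card (U k))"
      unfolding C_def by simp
    then have "(real (Max (U k)) - real (Inf (U k)) - C) / (real d * real k)
        \<le> real d * real (card (U k)) / (real d * real k)"
      by (intro divide_right_mono) auto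
    moreover have "1 / real d * (g k - C / real k)
        = (real (Max (U k)) - real (Inf (U k)) - C) / (real d * real k)"
      unfolding g_def by (simp add: diff_divide_distrib mult.commute)
    ultimately show ?case using d_pos by simp
  qed
  show "\<forall>\<^sub>F k in sequentially. real (card (U k)) / real k \<le> 1 / real d * (g k + real d / real k)"
    using eventually_gt_at_top[of 0]
  proof eventually_elim
    case (elim k)
    have "real (d * card (U k) + Inf (U k)) \<le> real (Max (U k) + d)"
      using card_upper of_nat_mono by blast
    then have "real d * real (card (U k)) \<le> real (Max (U k)) - real (Inf (U k)) + real d" by simp
    then have "real d * real (card (U k)) / (real d * real k)
        \<le> (real (Max (U k)) - real (Inf (U k)) + real d) / (real d * real k)"
      by (intro divide_right_mono) auto
    moreover have "1 / real d * (g k + real d / real k)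
        = (real (Max (U k)) - real (Inf (U k)) + real d) / (real d * real k)"
      unfolding g_def by (simp add: diff_divide_distrib add_divide_distrib mult.commute)
    ultimately show ?case using d_pos by simp
  qed
qed

end

end

subsection \<open>Sets of lengths in atomic monoids\<close>

lemma SUP_enat_finite:
  fixes A :: "nat set"
  assumes "finite A" "A \<noteq> {}"
  shows "(SUP l\<in>A. enat l) = enat (Max A)"
proof -
  have "mono enat" by (simp add: mono_def)
  then show ?thesis using assms mono_Max_commute[of enat A] by (simp add: Sup_enat_def)
qed

lemma SUP_enat_eq_infinity_iff:
  fixes A :: "nat set"
  shows "(SUP l\<in>A. enat l) = \<infinity> \<longleftrightarrow> infinite A"
proof
  assume "(SUP l\<in>A. enat l) = \<infinity>"
  then show "infinite A" using SUP_enat_finite[of A] by (cases "A = {}") (auto simp: bot_enat_def)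
next
  assume "infinite A"
  moreover have "inj_on enat A" by (simp add: inj_on_def)
  ultimately show "(SUP l\<in>A. enat l) = \<infinity>"
    using finite_imageD by (fastforce simp: Sup_enat_def)
qed

text \<open>For \<open>k \<ge> 1\<close> this is \<open>length_union G k\<close>; it has the value \<open>{0}\<close> at \<open>k = 0\<close>,
  which makes the additivity and symmetry laws hold without exceptions.\<close>

definition common_lengths :: "('a, 'b) monoid_scheme \<Rightarrow> nat \<Rightarrow> nat set" where
  "common_lengths G k = {l. \<exists>a\<in>carrier G. k \<in> length_set G a \<and> l \<in> length_set G a}"

section \<open>Products of atoms and factorization lengths in a cancellative monoid\<close>

context monoid_cancel
begin

text \<open>The right inverse \<open>c\<close> of \<open>a\<close> is two-sided, because
  \<open>a (c a) = (a c) a = a\<close> and \<open>a\<close> can be cancelled on the left.\<close>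

lemma Units_factor:
  assumes ab: "a \<otimes> b \<in> Units G" and carr: "a \<in> carrier G" "b \<in> carrier G"
  shows "a \<in> Units G" "b \<in> Units G"
proof -
  define c where "c = b \<otimes> inv (a \<otimes> b)"
  have c: "c \<in> carrier G" unfolding c_def using ab carr by simp
  have ac: "a \<otimes> c = \<one>" unfolding c_def using ab carr by (simp add: m_assoc[symmetric])
  have "a \<otimes> (c \<otimes> a) = a \<otimes> \<one>" using ac carr c by (simp add: m_assoc[symmetric])
  then have "c \<otimes> a = \<one>"
    by (rule l_cancel[OF _ m_closed[OF c carr(1)] one_closed carr(1)])
  then show a: "a \<in> Units G" unfolding Units_def using ac carr c by auto
  show "b \<in> Units G" by (rule prod_unit_l[OF ab a carr])
qed

lemma list_product_closed: "set us \<subseteq> carrier G \<Longrightarrow> list_product G us \<in> carrier G"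
  unfolding list_product_def by (induction us) auto

lemma list_product_append:
  "set us \<subseteq> carrier G \<Longrightarrow> set vs \<subseteq> carrier G \<Longrightarrow>
   list_product G (us @ vs) = list_product G us \<otimes> list_product G vs"
  using list_product_closed[of vs] list_product_closed
  by (induction us) (auto simp: list_product_def m_assoc)

lemma atoms_subset_carrier: "atoms G \<subseteq> carrier G"
  unfolding atoms_def by blast

lemma list_product_atoms_closed: "set us \<subseteq> atoms G \<Longrightarrow> list_product G us \<in> carrier G"
  using list_product_closed atoms_subset_carrier by blast

lemma list_product_atoms_not_Unit:
  assumes "set us \<subseteq> atoms G" "us \<noteq> []"
  shows "list_product G us \<notin> Units G"
proof -
  obtain u vs where us: "us = u # vs" using assms(2) by (cases us) auto
  have u: "u \<in> carrier G" "u \<notin> Units G" using assms us by (auto simp: atoms_def)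
  have vs: "list_product G vs \<in> carrier G" using assms us by (simp add: list_product_atoms_closed)
  have "list_product G us = u \<otimes> list_product G vs" unfolding us list_product_def by simp
  then show ?thesis using Units_factor(1) u vs by metis
qed

text \<open>A nonempty product of atoms is never a unit, so for \<open>k > 0\<close> the case
  distinction in \<open>length_set\<close> disappears.\<close>

lemma mem_length_set_iff:
  assumes "0 < k"
  shows "k \<in> length_set G a \<longleftrightarrow>
    (\<exists>us. length us = k \<and> set us \<subseteq> atoms G \<and> list_product G us = a)"
proof
  assume "k \<in> length_set G a"
  then show "\<exists>us. length us = k \<and> set us \<subseteq> atoms G \<and> list_product G us = a"
    using assms unfolding length_set_def by (simp split: if_splits)
next
  assume "\<exists>us. length us = k \<and> set us \<subseteq> atoms G \<and> list_product G us = a"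
  then obtain us where us: "length us = k" "set us \<subseteq> atoms G" "list_product G us = a" by blast
  then have "us \<noteq> []" using assms by auto
  then have "a \<notin> Units G" using list_product_atoms_not_Unit[OF us(2)] us(3) by simp
  then show "k \<in> length_set G a" using assms us unfolding length_set_def by auto
qed

lemma zero_mem_length_set_iff: "0 \<in> length_set G a \<longleftrightarrow> a \<in> Units G"
  unfolding length_set_def by auto

lemma length_set_Unit: "a \<in> Units G \<Longrightarrow> length_set G a = {0}"
  unfolding length_set_def by simp

lemma length_set_pos: "a \<notin> Units G \<Longrightarrow> k \<in> length_set G a \<Longrightarrow> 0 < k"
  unfolding length_set_def by auto

lemma length_union_eq_common_lengths:
  assumes "carrier G \<noteq> Units G" "0 < k"
  shows "length_union G k = common_lengths G k"
proof (intro equalityI subsetI)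
  fix l assume "l \<in> length_union G k"
  then obtain us vs where *: "1 \<le> l" "length us = k" "length vs = l" "set us \<subseteq> atoms G"
    "set vs \<subseteq> atoms G" "list_product G us = list_product G vs"
    using assms unfolding length_union_def by auto
  then show "l \<in> common_lengths G k"
    unfolding common_lengths_def using mem_length_set_iff assms(2) list_product_atoms_closed[OF *(4)]
    by (intro CollectI bexI[of _ "list_product G us"]) auto
next
  fix l assume "l \<in> common_lengths G k"
  then obtain a where a: "a \<in> carrier G" "k \<in> length_set G a" "l \<in> length_set G a"
    unfolding common_lengths_def by blast
  then have "0 < l" using assms(2) length_set_Unit length_set_pos by (metis neq0_conv singletonD)
  obtain us where us: "length us = k" "set us \<subseteq> atoms G" "list_product G us = a"
    using a(2) mem_length_set_iff[OF assms(2)] by blast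
  obtain vs where "length vs = l" "set vs \<subseteq> atoms G" "list_product G vs = a"
    using a(3) mem_length_set_iff[OF \<open>0 < l\<close>] by blast
  then have "\<exists>us vs. length us = k \<and> length vs = l \<and> set us \<subseteq> atoms G \<and> set vs \<subseteq> atoms G \<and>
      list_product G us = list_product G vs"
    using us by metis
  then show "l \<in> length_union G k"
    using assms(1) \<open>0 < l\<close> unfolding length_union_def by simp
qed

lemma common_lengths_zero: "common_lengths G 0 = {0}"
  unfolding common_lengths_def by (auto simp: zero_mem_length_set_iff length_set_Unit)

lemma common_lengths_sym: "l \<in> common_lengths G k \<Longrightarrow> k \<in> common_lengths G l"
  unfolding common_lengths_def by auto

text \<open>Factorizations of \<open>a\<close> and \<open>b\<close> are concatenated to
  factorizations of their product.\<close>

lemma common_lengths_add: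
  assumes "l \<in> common_lengths G k" "l' \<in> common_lengths G k'"
  shows "l + l' \<in> common_lengths G (k + k')"
proof (cases "k = 0 \<or> k' = 0 \<or> l = 0 \<or> l' = 0")
  case True
  \<comment> \<open>Only units have length 0, and they have no other length, so 0 is related to 0
    alone and one of the two summands is trivial.\<close>
  then have "(k = 0 \<and> l = 0) \<or> (k' = 0 \<and> l' = 0)"
    using assms common_lengths_sym common_lengths_zero by (metis singletonD)
  then show ?thesis using assms by auto
next
  case False
  obtain a where a: "k \<in> length_set G a" "l \<in> length_set G a"
    using assms(1) unfolding common_lengths_def by blast
  obtain b where b: "k' \<in> length_set G b" "l' \<in> length_set G b"
    using assms(2) unfolding common_lengths_def by blast
  have sum: "n + n' \<in> length_set G (a \<otimes> b) \<and> a \<otimes> b \<in> carrier G"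
    if pos: "0 < n" "0 < n'" and mem: "n \<in> length_set G a" "n' \<in> length_set G b" for n n'
  proof -
    obtain us where us: "length us = n" "set us \<subseteq> atoms G" "list_product G us = a"
      using mem(1) mem_length_set_iff[OF pos(1)] by blast
    obtain vs where vs: "length vs = n'" "set vs \<subseteq> atoms G" "list_product G vs = b"
      using mem(2) mem_length_set_iff[OF pos(2)] by blast
    have "list_product G (us @ vs) = a \<otimes> b"
      using list_product_append[of us vs] us vs atoms_subset_carrier by blast
    moreover have "length (us @ vs) = n + n'" "set (us @ vs) \<subseteq> atoms G" using us vs by auto
    moreover have "0 < n + n'" using pos(1) by simp
    ultimately show ?thesis
      using mem_length_set_iff list_product_atoms_closed by metis
  qed
  have "k + k' \<in> length_set G (a \<otimes> b)" "l + l' \<in> length_set G (a \<otimes> b)" "a \<otimes> b \<in> carrier G"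
    using sum[OF _ _ a(1) b(1)] sum[OF _ _ a(2) b(2)] False by auto
  then show ?thesis unfolding common_lengths_def by blast
qed

text \<open>The largest length up to \<open>t\<close> and the smallest length beyond
  \<open>t\<close> are adjacent in the set of lengths, so their difference is a distance.\<close>

lemma distances_consecutive:
  assumes a: "a \<in> carrier G" and ij: "i \<in> length_set G a" "j \<in> length_set G a" "i \<le> t" "t < j"
  obtains i' j' where "i' \<in> length_set G a" "j' \<in> length_set G a" "i \<le> i'" "i' \<le> t" "t < j'" "j' \<le> j"
    "j' - i' \<in> distances G"
proof -
  define A where "A = {n \<in> length_set G a. n \<le> t}"
  define B where "B = {n \<in> length_set G a. t < n}"
  have "finite A" "i \<in> A" using ij unfolding A_def by auto
  then have A: "Max A \<in> A" "\<And>n. n \<in> A \<Longrightarrow> n \<le> Max A" using Max_in by auto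
  have "j \<in> B" using ij unfolding B_def by auto
  then have B: "Inf B \<in> B" "\<And>n. n \<in> B \<Longrightarrow> Inf B \<le> n"
    using Inf_nat_def1 wellorder_Inf_le1 by blast+
  have lt: "Max A \<le> t" "t < Inf B" using A(1) B(1) unfolding A_def B_def by auto
  have mem: "Max A \<in> length_set G a" "Inf B \<in> length_set G a"
    using A(1) B(1) unfolding A_def B_def by auto
  have "{int (Max A)..int (Inf B)} \<inter> int ` length_set G a = {int (Max A), int (Inf B)}"
  proof (intro equalityI subsetI)
    fix z assume "z \<in> {int (Max A)..int (Inf B)} \<inter> int ` length_set G a"
    then obtain n where n: "z = int n" "n \<in> length_set G a" "Max A \<le> n" "n \<le> Inf B" by auto
    then have "n = Max A \<or> n = Inf B" using A(2)[of n] B(2)[of n] unfolding A_def B_def by fastforce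
    then show "z \<in> {int (Max A), int (Inf B)}" using n by auto
  qed (use mem lt in auto)
  moreover have "int (Inf B) - int (Max A) = int (Inf B - Max A)" using lt by simp
  ultimately have "Inf B - Max A \<in> set_distances (int ` length_set G a)"
    unfolding set_distances_def using mem lt by fastforce
  then have "Inf B - Max A \<in> distances G" unfolding distances_def length_system_def using a by blast
  then show ?thesis using that[OF mem] A(2)[OF \<open>i \<in> A\<close>] B(2)[OF \<open>j \<in> B\<close>] lt by blast
qed

lemma distances_witness:
  assumes "\<delta> \<in> distances G"
  obtains x where "0 < x" "0 < \<delta>" "x + \<delta> \<in> common_lengths G x"
proof -
  obtain a k l where *: "a \<in> carrier G" "k \<in> length_set G a" "l \<in> length_set G a"
    "int l - int k = int \<delta>" "0 < \<delta>"
    using assms unfolding distances_def length_system_def set_distances_def by auto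
  then have l: "l = k + \<delta>" by linarith
  then have "a \<notin> Units G" using * length_set_Unit by fastforce
  then have "0 < k" using * length_set_pos by blast
  then show ?thesis using that * l unfolding common_lengths_def by blast
qed

end

section \<open>Congruences, gaps and elasticity for finitely many distances\<close>

locale atomic_monoid_with_distances = monoid_cancel +
  assumes atomic: "atomic_monoid G" and distances_nonempty: "distances G \<noteq> {}"
    and distances_finite: "finite (distances G)"
begin

lemma carrier_ne_Units: "carrier G \<noteq> Units G"
proof
  assume eq: "carrier G = Units G"
  obtain \<delta> where "\<delta> \<in> distances G" using distances_nonempty by blast
  then obtain x where x: "0 < x" "x + \<delta> \<in> common_lengths G x" using distances_witness by metis
  then show False unfolding common_lengths_def eq using length_set_Unit by auto
qed

text \<open>A distance forces a nonunit and hence an atom to exist, and the \<open>k\<close>-th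
  power of an atom has length \<open>k\<close>.\<close>

lemma common_lengths_self: "k \<in> common_lengths G k"
proof (cases "k = 0")
  case True
  then show ?thesis using common_lengths_zero by simp
next
  case False
  obtain a where "a \<in> carrier G - Units G" using carrier_ne_Units Units_closed by blast
  then obtain us where us: "set us \<subseteq> atoms G" "list_product G us = a" "a \<notin> Units G"
    using atomic unfolding atomic_monoid_def by blast
  then have "us \<noteq> []" unfolding list_product_def by auto
  then obtain u where "u \<in> atoms G" using us by (cases us) auto
  then have "set (replicate k u) \<subseteq> atoms G" by auto
  then show ?thesis
    unfolding common_lengths_def using False mem_length_set_iff[of k] list_product_atoms_closed
    by (metis (mono_tags, lifting) mem_Collect_eq length_replicate neq0_conv)
qed

sublocale length_relation "common_lengths G"
  by (rule length_relation.intro) (fact common_lengths_zero common_lengths_self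
      common_lengths_sym common_lengths_add)+

text \<open>If \<open>d = Min (distances G)\<close> left the remainder \<open>r > 0\<close> on division of a distance, combining
  \<open>q\<close> copies of a witness for \<open>d\<close>, read backwards, with a witness for that distance would give
  two lengths that differ by \<open>r < d\<close>.\<close>

lemma Min_distances_dvd:
  assumes "\<delta> \<in> distances G"
  shows "Min (distances G) dvd \<delta>"
proof (rule ccontr)
  define d where "d = Min (distances G)"
  define q r where "q = \<delta> div d" and "r = \<delta> mod d"
  assume "\<not> Min (distances G) dvd \<delta>"
  then have r: "0 < r" unfolding r_def d_def by (simp add: dvd_eq_mod_eq_0)
  have "d \<in> distances G" unfolding d_def using distances_finite distances_nonempty by (rule Min_in)
  then obtain x where x: "0 < d" "x + d \<in> common_lengths G x" using distances_witness by metis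
  obtain y where y: "y + \<delta> \<in> common_lengths G y" using distances_witness[OF assms] by metis
  have "q * x + (y + \<delta>) \<in> common_lengths G (q * (x + d) + y)"
    by (intro mem_add mult y mem_sym[OF x(2)])
  moreover have "q * x + (y + \<delta>) = (q * (x + d) + y) + r"
    using div_mult_mod_eq[of \<delta> d] unfolding q_def[symmetric] r_def[symmetric]
    by (simp add: algebra_simps)
  ultimately obtain a where a: "a \<in> carrier G" "q * (x + d) + y \<in> length_set G a"
      "(q * (x + d) + y) + r \<in> length_set G a"
    unfolding common_lengths_def by auto
  obtain i j where ij: "j - i \<in> distances G" "q * (x + d) + y \<le> i" "j \<le> q * (x + d) + y + r"
    by (rule distances_consecutive[OF a order_refl]) (use r in auto)
  have "d \<le> j - i" unfolding d_def using ij distances_finite by simp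
  moreover have "r < d" unfolding r_def using x by simp
  ultimately show False using ij by linarith
qed

text \<open>One walks from \<open>i\<close> to \<open>j\<close> through adjacent lengths; each step
  is a distance and so a multiple of the least one.\<close>

lemma length_set_residue:
  assumes "a \<in> carrier G" "i \<in> length_set G a" "j \<in> length_set G a" "i \<le> j"
  shows "j mod Min (distances G) = i mod Min (distances G)"
  using assms(2-4)
proof (induction "j - i" arbitrary: i rule: less_induct)
  case less
  show ?case
  proof (cases "i = j")
    case False
    then have "i < j" using less by simp
    \<comment> \<open>The cut is made at \<open>t = i\<close>, which forces \<open>i' = i\<close>
      and makes \<open>j'\<close> the successor of \<open>i\<close>.\<close>
    then obtain i' j' where *: "i' \<in> length_set G a" "j' \<in> length_set G a" "i \<le> i'" "i' \<le> i" "i < j'"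
        "j' \<le> j" "j' - i' \<in> distances G"
      by (rule distances_consecutive[OF assms(1) less(2,3) order_refl])
    then have "i' = i" by simp
    then have "j' mod Min (distances G) = i mod Min (distances G)"
      using Min_distances_dvd * mod_eq_dvd_iff_nat by (metis less_imp_le)
    moreover have "j mod Min (distances G) = j' mod Min (distances G)"
      by (rule less.hyps) (use * less in auto)
    ultimately show ?thesis by simp
  qed simp
qed

lemma common_lengths_residue:
  assumes "l \<in> common_lengths G k"
  shows "l mod Min (distances G) = k mod Min (distances G)"
proof -
  obtain a where a: "a \<in> carrier G" "k \<in> length_set G a" "l \<in> length_set G a"
    using assms unfolding common_lengths_def by blast
  show ?thesis
  proof (cases "k \<le> l")
    case True
    then show ?thesis using length_set_residue[OF a] by simp
  next
    case False
    then show ?thesis using length_set_residue[OF a(1,3,2)] by simp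
  qed
qed

text \<open>The lengths \<open>i\<close> and \<open>j\<close> may belong to different elements, so a
  single element is needed whose lengths include \<open>k\<close> and jump over \<open>i\<close>. If
  \<open>i < k\<close>, the element with lengths \<open>k\<close> and \<open>i\<close> will do; if
  \<open>k \<le> i\<close>, the one with lengths \<open>k\<close> and \<open>j\<close>.\<close>

lemma common_lengths_gap:
  assumes i: "i \<in> common_lengths G k" and j: "j \<in> common_lengths G k" and "i < j"
  shows "\<exists>i'\<in>common_lengths G k. i < i' \<and> i' \<le> i + Max (distances G)"
proof -
  have "\<exists>a\<in>carrier G. \<exists>p q. k \<in> length_set G a \<and>
      p \<in> length_set G a \<and> q \<in> length_set G a \<and> p \<le> i \<and> i < q"
  proof (cases "i < k")
    case True
    then show ?thesis using i unfolding common_lengths_def by blast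
  next
    case False
    then have "k \<le> i" by simp
    then show ?thesis using j \<open>i < j\<close> unfolding common_lengths_def by blast
  qed
  then obtain a p q where a: "a \<in> carrier G" "k \<in> length_set G a"
    and pq: "p \<in> length_set G a" "q \<in> length_set G a" "p \<le> i" "i < q"
    by blast
  obtain i' j' where *: "j' \<in> length_set G a" "i' \<le> i" "i < j'" "j' - i' \<in> distances G"
    by (rule distances_consecutive[OF a(1) pq])
  have "j' - i' \<le> Max (distances G)" using * distances_finite by simp
  then have "j' \<le> i + Max (distances G)" using * by linarith
  moreover have "j' \<in> common_lengths G k" unfolding common_lengths_def using a * by blast
  ultimately show ?thesis using * by blast
qed

lemma length_set_nonempty:
  assumes "a \<in> carrier G"
  shows "length_set G a \<noteq> {}"
proof (cases "a \<in> Units G")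
  case True
  then show ?thesis by (simp add: length_set_Unit)
next
  case False
  then obtain us where us: "set us \<subseteq> atoms G" "list_product G us = a"
    using atomic assms unfolding atomic_monoid_def by blast
  then have "us \<noteq> []" using False unfolding list_product_def by auto
  then show ?thesis using us mem_length_set_iff[of "length us" a] by auto
qed

lemma elasticity_upper:
  assumes "l \<in> common_lengths G k" "0 < k"
  shows "ereal (real l / real k) \<le> elasticity G"
proof -
  obtain a where a: "a \<in> carrier G" "k \<in> length_set G a" "l \<in> length_set G a"
    using assms unfolding common_lengths_def by blast
  define L where "L = length_set G a"
  have ne: "L \<noteq> {0}" using a(2) assms(2) unfolding L_def by (metis less_irrefl singletonD)
  then have "a \<notin> Units G" using length_set_Unit unfolding L_def by blast
  have Inf: "Inf L \<in> L" "Inf L \<le> k"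
    using a Inf_nat_def1 wellorder_Inf_le1 unfolding L_def by blast+
  have pos: "0 < Inf L" using Inf(1) length_set_pos[OF \<open>a \<notin> Units G\<close>] unfolding L_def by blast
  have "real l / real k \<le> real l / real (Inf L)"
    by (rule divide_left_mono) (use Inf pos assms in auto)
  then have "ereal (real l / real k) \<le> ereal (real l) / ereal (real (Inf L))" using pos by simp
  also have "\<dots> \<le> (SUP l\<in>L. ereal (real l)) / ereal (real (Inf L))"
    by (intro ereal_divide_right_mono SUP_upper) (use a pos L_def in auto)
  also have "\<dots> = set_elasticity L" unfolding set_elasticity_def using ne by simp
  also have "\<dots> \<le> elasticity G"
    unfolding elasticity_def length_system_def L_def using a by (auto intro: SUP_upper)
  finally show ?thesis .
qed

text \<open>With \<open>k\<close> the minimum of a set of lengths of large elasticity, some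
  \<open>l\<close> in that set already makes \<open>l / k\<close> exceed \<open>c\<close>.\<close>

lemma elasticity_approx:
  assumes "c < elasticity G"
  obtains k l where "0 < k" "l \<in> common_lengths G k" "c < ereal (real l / real k)"
proof -
  obtain a where a: "a \<in> carrier G" "c < set_elasticity (length_set G a)"
    using assms unfolding elasticity_def length_system_def by (auto simp: less_SUP_iff)
  show ?thesis
  proof (cases "a \<in> Units G")
    case True
    \<comment> \<open>The set \<open>{0}\<close> has elasticity 1 by convention; the pair
      \<open>k = l = 1\<close> attains this value with a positive denominator.\<close>
    then have "c < ereal (real 1 / real 1)"
      using a by (simp add: length_set_Unit set_elasticity_def one_ereal_def)
    then show ?thesis using that[of 1 1] self_mem by simp
  next
    case False
    define L where "L = length_set G a"
    define k where "k = Inf L"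
    have k: "k \<in> L" unfolding k_def L_def using length_set_nonempty[OF a(1)] Inf_nat_def1 by blast
    have pos: "0 < k" using k False length_set_pos unfolding L_def by blast
    have "L \<noteq> {0}" using k pos by auto
    then have c: "c < (SUP l\<in>L. ereal (real l)) / ereal (real k)"
      using a unfolding set_elasticity_def L_def k_def by simp
    have "\<exists>l\<in>L. c < ereal (real l / real k)"
    proof (rule ccontr)
      assume *: "\<not> ?thesis"
      have "ereal (real l) \<le> ereal (real k) * c" if "l \<in> L" for l
      proof -
        have "ereal (real l) / ereal (real k) \<le> c" using * that pos by (simp add: not_less)
        then show ?thesis using pos by (subst (asm) ereal_divide_le_pos) auto
      qed
      then have "(SUP l\<in>L. ereal (real l)) \<le> ereal (real k) * c" by (rule SUP_least)
      then have "(SUP l\<in>L. ereal (real l)) / ereal (real k) \<le> c"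
        using pos by (subst ereal_divide_le_pos) auto
      then show False using c by simp
    qed
    then obtain l where "l \<in> L" "c < ereal (real l / real k)" by blast
    moreover have "l \<in> common_lengths G k" if "l \<in> L" for l
      using that k a(1) unfolding common_lengths_def L_def by blast
    ultimately show ?thesis using that pos by blast
  qed
qed

end

theorem theorem2p6:
  fixes H :: "('a, 'b) monoid_scheme" and d :: nat
  assumes "atomic_monoid H"
    and "finite (distances H)" and "distances H \<noteq> {}"
    and "d = Min (distances H)"
    and "(\<exists>k\<ge>1. elasticity_k H k = \<infinity>) \<or>
         (\<exists>M::nat. M \<ge> 1 \<and> (\<forall>k\<ge>2. elasticity_k H k - elasticity_k H (k - 1) \<le> enat M))"
  shows "(\<exists>k0 M0::nat. k0 \<ge> 1 \<and> M0 \<ge> 1 \<and>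
            (\<forall>k\<ge>k0. almost_arith_progression d M0 (int ` length_union H k))) \<and>
         ((\<forall>k\<ge>1. elasticity_k H k < \<infinity>) \<longrightarrow>
            (\<exists>M0::nat. M0 \<ge> 1 \<and>
              (\<forall>k\<ge>1. almost_arith_progression d M0 (int ` length_union H k)))) \<and>
         ((\<lambda>k. ereal_of_enat (ecard (length_union H k)) / ereal (real k))
            \<longlonglongrightarrow> 1 / ereal (real d) * (elasticity H - 1 / elasticity H))"
proof -
  interpret monoid_cancel H using assms(1) unfolding atomic_monoid_def by simp
  interpret atomic_monoid_with_distances H by unfold_locales (use assms in auto)
  define U where "U = common_lengths H"
  have d: "d \<in> distances H" using assms Min_in by blast
  obtain x where x: "0 < x" "0 < d" "x + d \<in> U x"
    using distances_witness[OF d] unfolding U_def by metis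
  have D: "0 < Max (distances H)" using d x assms(2) Max_ge by (metis less_le_trans)
  interpret length_unions U d "Max (distances H)" x
    unfolding U_def
    by unfold_locales (use x D assms(4) common_lengths_gap common_lengths_residue U_def in auto)
  have union: "length_union H k = U k" if "k \<ge> 1" for k
    using that length_union_eq_common_lengths[OF carrier_ne_Units] unfolding U_def by simp
  have infinite_iff: "elasticity_k H k = \<infinity> \<longleftrightarrow> infinite (U k)" if "k \<ge> 1" for k
    unfolding elasticity_k_def union[OF that] by (rule SUP_enat_eq_infinity_iff)
  show ?thesis
  proof (cases "\<exists>k\<ge>1. infinite (U k)")
    case True
    then obtain k1 where k1: "k1 \<ge> 1" "infinite (U k1)" by blast
    \<comment> \<open>Beyond \<open>k1 + m\<close> the shifted set \<open>U (k - m)\<close> is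
      infinite as well.\<close>
    have "almost_arith_progression d (m + 2 * m * d) (int ` length_union H k)" if "k \<ge> k1 + m" for k
    proof -
      have "infinite (U (k - m))" using infinite_mono[OF k1(2)] that by simp
      then show ?thesis using almost_arith_progression_infinite that k1 union by simp
    qed
    moreover have "\<not> (\<forall>k\<ge>1. elasticity_k H k < \<infinity>)" using infinite_iff k1 by fastforce
    moreover have "(\<lambda>k. ereal_of_enat (ecard (length_union H k)) / ereal (real k))
            \<longlonglongrightarrow> 1 / ereal (real d) * (elasticity H - 1 / elasticity H)"
    proof (rule tendsto_eventually)
      \<comment> \<open>The numerators in \<open>U k1\<close> are unbounded while the denominator
        \<open>k1\<close> is fixed. With \<open>1 / \<infinity> = 0\<close> both sides of the limit
        are then infinite from \<open>k1\<close> on.\<close>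
      have "elasticity H = \<infinity>"
      proof (rule ereal_top)
        fix B :: real
        obtain l where l: "l \<in> U k1" "nat \<lceil>B * real k1\<rceil> \<le> l"
          using k1(2) by (meson finite_nat_set_iff_bounded_le nat_le_linear)
        then have "B * real k1 \<le> real l" by linarith
        then have "B \<le> real l / real k1" using k1(1) by (simp add: field_simps)
        then show "ereal B \<le> elasticity H"
          using elasticity_upper l(1) k1(1) unfolding U_def
          by (metis ereal_less_eq(3) order_trans less_le_trans zero_less_one)
      qed
      then have rhs: "1 / ereal (real d) * (elasticity H - 1 / elasticity H) = \<infinity>"
        using x by (simp add: one_ereal_def)
      show "\<forall>\<^sub>F k in sequentially. ereal_of_enat (ecard (length_union H k)) / ereal (real k)
        = 1 / ereal (real d) * (elasticity H - 1 / elasticity H)"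
        using eventually_ge_at_top[of k1]
      proof eventually_elim
        case (elim k)
        have "infinite (U k)" using infinite_mono[OF k1(2)] elim by simp
        then show ?case unfolding rhs using union elim k1 by (simp add: ecard_def)
      qed
    qed
    moreover have "k1 + m \<ge> 1" "m + 2 * m * d \<ge> 1" using k1(1) m_pos by simp_all
    ultimately show ?thesis by blast
  next
    case False
    then have fin: "finite (U k)" for k using zero by (cases "k = 0") auto
    have elasticity_k: "elasticity_k H k = enat (Max (U k))" if "k \<ge> 1" for k
      unfolding elasticity_k_def union[OF that] using fin self_mem by (intro SUP_enat_finite) auto
    obtain M where M: "\<And>k. k \<ge> 2 \<Longrightarrow> elasticity_k H k - elasticity_k H (k - 1) \<le> enat M"
      using assms(5) False infinite_iff by blast
    \<comment> \<open>The hypothesis bounds the increments only from \<open>k = 2\<close> on; the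
      increment from \<open>U 0 = {0}\<close> to \<open>U 1\<close> is
      \<open>Max (U 1)\<close>.\<close>
    define M' where "M' = max M (Max (U 1))"
    interpret finite_length_unions U d "Max (distances H)" x M'
    proof unfold_locales
      show "finite (U k)" for k by (rule fin)
      show "Max (U (Suc k)) \<le> Max (U k) + M'" for k
      proof (cases "k = 0")
        case True
        then show ?thesis unfolding M'_def by simp
      next
        case False
        then have "enat (Max (U (Suc k))) - enat (Max (U k)) \<le> enat M"
          using M[of "Suc k"] elasticity_k by simp
        then show ?thesis unfolding M'_def by simp
      qed
    qed
    have aap: "almost_arith_progression d (m + 2 * m * d + m * M') (int ` length_union H k)"
      if "k \<ge> 1" for k using almost_arith_progression_finite union that by simp
    \<comment> \<open>Linear growth \<open>Max (U k) \<le> k * M'\<close> makes the elasticity a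
      real number \<open>R\<close>, as the limit computation over the reals requires.\<close>
    have "elasticity H \<le> ereal (real M')"
    proof (rule ccontr)
      assume "\<not> ?thesis"
      then obtain k l where kl: "0 < k" "l \<in> U k" "ereal (real M') < ereal (real l / real k)"
        using elasticity_approx unfolding U_def by (metis not_less)
      have "l \<le> k * M'" using le_Max[OF kl(2)] Max_le[of k] by simp
      then have "real l \<le> real k * real M'" by (metis of_nat_mult of_nat_mono)
      then show False using kl by (simp add: field_simps)
    qed
    moreover have "ereal (real 1 / real 1) \<le> elasticity H"
      using elasticity_upper[OF common_lengths_self] by (metis zero_less_one)
    ultimately obtain R where R: "elasticity H = ereal R" by (cases "elasticity H") auto
    have upper: "real l \<le> R * real k" if "l \<in> U k" for l k
    proof (cases "k = 0")
      case True
      then show ?thesis using that zero by simp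
    next
      case False
      then show ?thesis using elasticity_upper[of l k] that R unfolding U_def by (simp add: field_simps)
    qed
    have approx: "\<exists>k l. 0 < k \<and> l \<in> U k \<and> c < real l / real k" if "c < R" for c
      using elasticity_approx[of "ereal c"] that R unfolding U_def by (metis less_ereal.simps(1))
    have R1: "1 \<le> R" using R_ge_1[OF upper approx] .
    have rhs: "1 / ereal (real d) * (elasticity H - 1 / elasticity H)
        = ereal (1 / real d * (R - 1 / R))"
      unfolding R using R1 x by (simp add: one_ereal_def)
    have "(\<lambda>k. ereal (real (card (U k)) / real k)) \<longlonglongrightarrow> ereal (1 / real d * (R - 1 / R))"
      using card_tendsto[OF upper approx] by (intro tendsto_ereal)
    moreover have "\<forall>\<^sub>F k in sequentially. ereal (real (card (U k)) / real k)
        = ereal_of_enat (ecard (length_union H k)) / ereal (real k)"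
      using eventually_ge_at_top[of 1]
    proof eventually_elim
      case (elim k)
      then show ?case using union fin by (simp add: ecard_def)
    qed
    ultimately have "(\<lambda>k. ereal_of_enat (ecard (length_union H k)) / ereal (real k))
            \<longlonglongrightarrow> 1 / ereal (real d) * (elasticity H - 1 / elasticity H)"
      unfolding rhs by (rule Lim_transform_eventually)
    moreover have "m + 2 * m * d + m * M' \<ge> 1" "(1::nat) \<ge> 1" using m_pos by simp_all
    ultimately show ?thesis using aap by blast
  qed
qed

end
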